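(* For each $k\in\mathbb{N}$, the pair $(\mathfrak{g}_k,[\cdot,\cdot]_{\mathfrak{g}_k})$ is a Lie algebra. Furthermore, the bracket $[\cdot,\cdot]_{\mathfrak{g}_k}:\mathfrak{g}_k\times\mathfrak{g}_k\to\mathfrak{g}_k$ is a continuous bilinear map.
   Context: Fix $d\in\mathbb{N}=\{1,2,\dots\}$. Points of $\mathbb{R}^{2d}$ are $z=(x,v)$ with $x,v\in\mathbb{R}^d$, and $\underline{z}_k=(z_1,\dots,z_k)\in(\mathbb{R}^{2d})^k$. $\mathbb{S}_k$ is the symmetric group on $k$ letters. $\mathfrak{g}_k$ is the real vector space of smooth functions $f:(\mathbb{R}^{2d})^k\to\mathbb{R}$ with $f(z_{\pi(1)},\dots,z_{\pi(k)})=f(z_1,\dots,z_k)$ for all $\pi\in\mathbb{S}_k$, with the locally convex topology generated by the seminorms $\rho_{K,n}(f)=\sup_{|\alpha|\le n}\|\partial^\alpha f\|_{L^\infty(K)}$, where $K\subset(\mathbb{R}^{2d})^k$ is compact and $n\in\mathbb{N}$. The standard Poisson bracket on $(\mathbb{R}^{2d})^k$ is $\{f,g\}_{(\mathbb{R}^{2d})^k}=\sum_{i=1}^k(\nabla_{x_i}f\cdot\nabla_{v_i}g-\nabla_{v_i}f\cdot\nabla_{x_i}g)$, and $[f,g]_{\mathfrak{g}_k}:=k\{f,g\}_{(\mathbb{R}^{2d})^k}$. A Lie algebra means a real locally convex topological vector space $\mathfrak{g}$ with a bilinear, antisymmetric map $[\cdot,\cdot]:\mathfrak{g}\times\mathfrak{g}\to\mathfrak{g}$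 satisfying the Jacobi identity (no continuity is part of the definition). *)

theory Defs
  imports "HOL-Analysis.Analysis" "HOL-Library.Function_Algebras"
begin

instantiation "fun" :: (type, real_vector) real_vector
begin

definition scaleR_fun :: "real \<Rightarrow> ('a \<Rightarrow> 'b) \<Rightarrow> 'a \<Rightarrow> 'b"
  where "scaleR_fun c f = (\<lambda>x. c *\<^sub>R f x)"

instance
  by standard (simp_all add: scaleR_fun_def fun_eq_iff algebra_simps)

end


subsection \<open>Locally convex spaces and Lie algebras\<close>

text \<open>
  A real vector space is given as a linear subspace \<open>V\<close> of an ambient real vector type, and its
  topology as an abstract topology with underlying set \<open>V\<close>. No Hausdorff condition is imposed.
\<close>

definition locally_convex_tvs :: "'a::real_vector set \<Rightarrow> 'a topology \<Rightarrow> bool" where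
  "locally_convex_tvs V T \<longleftrightarrow>
     subspace V \<and> topspace T = V \<and>
     continuous_map (prod_topology T T) T (\<lambda>(x, y). x + y) \<and>
     continuous_map (prod_topology euclideanreal T) T (\<lambda>(c, x). c *\<^sub>R x) \<and>
     (\<forall>U. openin T U \<and> 0 \<in> U \<longrightarrow> (\<exists>W. openin T W \<and> 0 \<in> W \<and> convex W \<and> W \<subseteq> U))"

definition bilinear_on :: "'a::real_vector set \<Rightarrow> ('a \<Rightarrow> 'a \<Rightarrow> 'a) \<Rightarrow> bool" where
  "bilinear_on V B \<longleftrightarrow>
     (\<forall>x\<in>V. \<forall>y\<in>V. B x y \<in> V) \<and>
     (\<forall>x\<in>V. \<forall>y\<in>V. \<forall>z\<in>V. B (x + y) z = B x z + B y z \<and> B z (x + y) = B z x + B z y) \<and>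
     (\<forall>c. \<forall>x\<in>V. \<forall>y\<in>V. B (c *\<^sub>R x) y = c *\<^sub>R B x y \<and> B x (c *\<^sub>R y) = c *\<^sub>R B x y)"

text \<open>Continuity of the bracket is not part of the definition.\<close>

definition lie_algebra :: "'a::real_vector set \<Rightarrow> 'a topology \<Rightarrow> ('a \<Rightarrow> 'a \<Rightarrow> 'a) \<Rightarrow> bool" where
  "lie_algebra V T B \<longleftrightarrow>
     locally_convex_tvs V T \<and>
     bilinear_on V B \<and>
     (\<forall>x\<in>V. \<forall>y\<in>V. B x y = - B y x) \<and>
     (\<forall>x\<in>V. \<forall>y\<in>V. \<forall>z\<in>V. B x (B y z) + B y (B z x) + B z (B x y) = 0)"

text \<open>The topology on \<open>V\<close> having the open \<open>p\<close>-balls, for \<open>p\<close> in the family \<open>P\<close>, as a subbasis.\<close>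

definition seminorm_topology :: "'a::real_vector set \<Rightarrow> ('a \<Rightarrow> real) set \<Rightarrow> 'a topology" where
  "seminorm_topology V P =
     topology_generated_by {{g \<in> V. p (g - f) < e} | p f e. p \<in> P \<and> f \<in> V \<and> 0 < e}"


subsection \<open>Partial derivatives and smooth functions\<close>

definition partial_deriv :: "'a::euclidean_space \<Rightarrow> ('a \<Rightarrow> real) \<Rightarrow> 'a \<Rightarrow> real" where
  "partial_deriv b f z = deriv (\<lambda>t. f (z + t *\<^sub>R b)) 0"

text \<open>Infinitely differentiable: all iterated partial derivatives are Frechet differentiable.\<close>

definition smooth :: "('a::euclidean_space \<Rightarrow> real) \<Rightarrow> bool" where
  "smooth f \<longleftrightarrow>
     (\<forall>bs. set bs \<subseteq> Basis \<longrightarrow> (\<forall>z. foldr partial_deriv bs f differentiable (at z)))"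

definition basis_list :: "'a::euclidean_space list" where
  "basis_list = (SOME bs. distinct bs \<and> set bs = Basis)"

text \<open>
  A multi-index assigns an exponent to each coordinate direction; values outside \<open>Basis\<close> are
  irrelevant. The partial derivatives are taken in the order fixed by \<open>basis_list\<close>.
\<close>

definition multi_order :: "('a::euclidean_space \<Rightarrow> nat) \<Rightarrow> nat" where
  "multi_order \<alpha> = (\<Sum>b\<in>Basis. \<alpha> b)"

definition multi_deriv :: "('a::euclidean_space \<Rightarrow> nat) \<Rightarrow> ('a \<Rightarrow> real) \<Rightarrow> 'a \<Rightarrow> real" where
  "multi_deriv \<alpha> f = foldr (\<lambda>b. partial_deriv b ^^ \<alpha> b) basis_list f"

text \<open>
  The functions measured here are continuous, so the uniform norm on \<open>K\<close> is the supremum over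
  \<open>K\<close>. Inserting \<open>0\<close> only serves to give the value \<open>0\<close> for empty \<open>K\<close>.
\<close>

definition sup_norm_on :: "'a set \<Rightarrow> ('a \<Rightarrow> real) \<Rightarrow> real" where
  "sup_norm_on K f = Sup (insert 0 ((\<lambda>z. \<bar>f z\<bar>) ` K))"

definition smooth_seminorm :: "'a::euclidean_space set \<Rightarrow> nat \<Rightarrow> ('a \<Rightarrow> real) \<Rightarrow> real" where
  "smooth_seminorm K n f = (SUP \<alpha>\<in>{\<alpha>. multi_order \<alpha> \<le> n}. sup_norm_on K (multi_deriv \<alpha> f))"


subsection \<open>Symmetric observables and their Poisson bracket\<close>

text \<open>
  The \<open>k\<close>-particle phase space, with \<open>d = CARD('d)\<close> and \<open>k = CARD('k)\<close>; particle \<open>i\<close> has position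
  \<open>fst (z $ i)\<close> and velocity \<open>snd (z $ i)\<close>.
\<close>

type_synonym ('d, 'k) phase = "((real^'d) \<times> (real^'d))^'k"

definition \<gg> :: "(('d::finite, 'k::finite) phase \<Rightarrow> real) set" where
  "\<gg> = {f. smooth f \<and> (\<forall>\<pi>. \<pi> permutes UNIV \<longrightarrow> (\<forall>z. f (\<chi> i. z $ \<pi> i) = f z))}"

definition \<gg>_topology :: "(('d::finite, 'k::finite) phase \<Rightarrow> real) topology" where
  "\<gg>_topology = seminorm_topology \<gg> {smooth_seminorm K n | K n. compact K \<and> 1 \<le> n}"

definition grad_x :: "'k \<Rightarrow> (('d::finite, 'k::finite) phase \<Rightarrow> real) \<Rightarrow> ('d, 'k) phase \<Rightarrow> real^'d" where
  "grad_x i f z = (\<chi> j. partial_deriv (axis i (axis j 1, 0)) f z)"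

definition grad_v :: "'k \<Rightarrow> (('d::finite, 'k::finite) phase \<Rightarrow> real) \<Rightarrow> ('d, 'k) phase \<Rightarrow> real^'d" where
  "grad_v i f z = (\<chi> j. partial_deriv (axis i (0, axis j 1)) f z)"

definition poisson :: "(('d::finite, 'k::finite) phase \<Rightarrow> real) \<Rightarrow> (('d, 'k) phase \<Rightarrow> real)
    \<Rightarrow> ('d, 'k) phase \<Rightarrow> real" where
  "poisson f g z = (\<Sum>i\<in>UNIV. grad_x i f z \<bullet> grad_v i g z - grad_v i f z \<bullet> grad_x i g z)"

definition \<gg>_bracket :: "(('d::finite, 'k::finite) phase \<Rightarrow> real) \<Rightarrow> (('d, 'k) phase \<Rightarrow> real)
    \<Rightarrow> ('d, 'k) phase \<Rightarrow> real" where
  "\<gg>_bracket f g = real CARD('k) *\<^sub>R poisson f g"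

end

theory Submission imports Defs
begin

text \<open>
  By symmetry of mixed partial derivatives, \<open>smooth_seminorm K n f\<close> is the least common bound on
  \<open>K\<close> of all iterated partial derivatives of \<open>f\<close> along at most \<open>n\<close> directions. The Leibniz rule
  then bounds the seminorm of order \<open>n\<close> of the bracket by a constant times the product of the
  seminorms of order \<open>n + 1\<close>, which gives continuity. The Jacobi identity is a double sum over
  pairs \<open>(p, q)\<close> of coordinate indices whose \<open>(p, q)\<close> and \<open>(q, p)\<close> terms cancel.
  Relabelling the particles permutes the summands of the Poisson bracket of symmetric functions.
\<close>

subsection \<open>Topologies generated by seminorms\<close>

text \<open>Only for smooth functions do these suprema behave like seminorms; elsewhere iterated
  derivatives may fail to exist and real suprema of unbounded sets say nothing. The topological part
  is therefore relative to a subspace \<open>V\<close>, and continuity is translated into limits of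
  real numbers, where limit arithmetic is available.

  The bracket differentiates each argument once and then multiplies pointwise. It is local, so the
  compact set stays the same and only the order rises, from \<open>n\<close> to
  \<open>Suc n\<close>. That the bounding seminorm lies in the same family is what the continuity
  criterion asks for.

  In the Jacobi identity nothing cancels within one nested bracket. A second derivative of
  \<open>g\<close> coming from \<open>f\<close> bracketed with the bracket of \<open>g\<close> and
  \<open>h\<close> is matched by one coming from \<open>h\<close> bracketed with the bracket of
  \<open>f\<close> and \<open>g\<close>, with the two index pairs interchanged. The match requires
  mixed partial derivatives to commute, so that symmetry serves the algebra as well as the
  estimates.\<close>

definition seminorm_on :: "'a::real_vector set \<Rightarrow> ('a \<Rightarrow> real) \<Rightarrow> bool" where
  "seminorm_on V p \<longleftrightarrow>
     (\<forall>x\<in>V. \<forall>y\<in>V. p (x + y) \<le> p x + p y) \<and> (\<forall>c. \<forall>x\<in>V. p (c *\<^sub>R x) = \<bar>c\<bar> * p x)"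

lemma seminorm_onD:
  assumes "seminorm_on V p"
  shows seminorm_on_triangle: "x \<in> V \<Longrightarrow> y \<in> V \<Longrightarrow> p (x + y) \<le> p x + p y"
    and seminorm_on_scaleR: "x \<in> V \<Longrightarrow> p (c *\<^sub>R x) = \<bar>c\<bar> * p x"
  using assms by (auto simp: seminorm_on_def)

lemma seminorm_on_zero:
  assumes "subspace V" "seminorm_on V p"
  shows "p 0 = 0"
  using seminorm_on_scaleR[OF assms(2) subspace_0[OF assms(1)], of 0] by simp

text \<open>The triangle inequality at \<open>x\<close> and \<open>- x\<close> gives
  \<open>0 = p 0 \<le> 2 * p x\<close>.\<close>

lemma seminorm_on_nonneg:
  assumes V: "subspace V" and p: "seminorm_on V p" and x: "x \<in> V"
  shows "0 \<le> p x"
proof -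
  have "p (x + (-1) *\<^sub>R x) \<le> p x + p ((-1) *\<^sub>R x)"
    by (rule seminorm_on_triangle[OF p x subspace_scale[OF V x]])
  then show ?thesis
    using seminorm_on_scaleR[OF p x, of "-1"] seminorm_on_zero[OF V p] by simp
qed

text \<open>A nonempty \<open>P\<close> makes the subbasic balls cover \<open>V\<close>; an empty
  one would generate the topology with empty underlying set.\<close>

locale seminormed_space =
  fixes V :: "'a::real_vector set" and P :: "('a \<Rightarrow> real) set"
  assumes subspace: "subspace V"
    and seminorm: "\<And>p. p \<in> P \<Longrightarrow> seminorm_on V p"
    and nonempty: "P \<noteq> {}"
begin

lemma topspace [simp]: "topspace (seminorm_topology V P) = V"
proof -
  obtain p where p: "p \<in> P" using nonempty by blast
  have "x \<in> {g \<in> V. p (g - x) < 1}" if "x \<in> V" for x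
    using that seminorm_on_zero[OF subspace seminorm[OF p]] by simp
  then have "V \<subseteq> \<Union>{{g \<in> V. p (g - f) < e} | p f e. p \<in> P \<and> f \<in> V \<and> 0 < e}"
    using p zero_less_one by blast
  then show ?thesis
    unfolding seminorm_topology_def topology_generated_by_topspace by blast
qed

lemma openin_ball:
  assumes "p \<in> P" "f \<in> V" "0 < e"
  shows "openin (seminorm_topology V P) {g \<in> V. p (g - f) < e}"
  unfolding seminorm_topology_def
  by (rule topology_generated_by_Basis) (use assms in blast)

text \<open>The ball of radius \<open>e\<close> centred at \<open>F x\<close> is open, so its
  preimage is a neighbourhood of \<open>x\<close>. This and \<open>continuous_mapI\<close> together
  characterise continuity by real limits.\<close>

lemma tendsto_atin:
  assumes F: "continuous_map X (seminorm_topology V P) F" and p: "p \<in> P" and x: "x \<in> topspace X"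
  shows "((\<lambda>y. p (F y - F x)) \<longlongrightarrow> 0) (atin X x)"
proof (rule tendstoI)
  fix e :: real assume e: "0 < e"
  have FV: "F y \<in> V" if "y \<in> topspace X" for y
    using continuous_map_image_subset_topspace[OF F] that by auto
  let ?U = "{y \<in> topspace X. F y \<in> {g \<in> V. p (g - F x) < e}}"
  have "openin X ?U"
    by (rule openin_continuous_map_preimage[OF F openin_ball[OF p FV[OF x] e]])
  moreover have "x \<in> ?U"
    using x e FV seminorm_on_zero[OF subspace seminorm[OF p]] by simp
  moreover have "dist (p (F y - F x)) 0 < e" if "y \<in> ?U" for y
    using that seminorm_on_nonneg[OF subspace seminorm[OF p] subspace_diff[OF subspace, of "F y" "F x"]]
      FV[OF x] by simp
  ultimately show "\<forall>\<^sub>F y in atin X x. dist (p (F y - F x)) 0 < e"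
    unfolding eventually_atin by blast
qed

text \<open>Preimages of subbasic balls suffice. Such a ball is centred at an arbitrary
  \<open>f\<close> rather than at \<open>F x\<close>, so the triangle inequality has to move the
  centre.\<close>

lemma continuous_mapI:
  assumes FV: "\<And>x. x \<in> topspace X \<Longrightarrow> F x \<in> V"
    and lim: "\<And>p x. p \<in> P \<Longrightarrow> x \<in> topspace X \<Longrightarrow> ((\<lambda>y. p (F y - F x)) \<longlongrightarrow> 0) (atin X x)"
  shows "continuous_map X (seminorm_topology V P) F"
proof -
  have "openin X (F -` U \<inter> topspace X)"
    if "U \<in> {{g \<in> V. p (g - f) < e} | p f e. p \<in> P \<and> f \<in> V \<and> 0 < e}" for U
  proof -
    from that obtain p f e where U: "U = {g \<in> V. p (g - f) < e}" and p: "p \<in> P" and f: "f \<in> V"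
      by blast
    show ?thesis
    proof (subst openin_subopen, rule ballI)
      fix x assume "x \<in> F -` U \<inter> topspace X"
      then have x: "x \<in> topspace X" "p (F x - f) < e" by (auto simp: U)
      \<comment> \<open>The distance from \<open>F x\<close> to the boundary of the ball, measured
        by \<open>p\<close>, is the room left for \<open>F y\<close>.\<close>
      have "\<forall>\<^sub>F y in atin X x. p (F y - F x) < e - p (F x - f)"
        using order_tendstoD(2)[OF lim[OF p x(1)]] x(2) by simp
      then obtain W where W: "openin X W" "x \<in> W"
        and less: "\<And>y. y \<in> W - {x} \<Longrightarrow> p (F y - F x) < e - p (F x - f)"
        using x(1) unfolding eventually_atin by blast
      have "y \<in> F -` U \<inter> topspace X" if y: "y \<in> W" for y
      proof -
        have yX: "y \<in> topspace X" using openin_subset[OF W(1)] y by blast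
        have "p ((F y - F x) + (F x - f)) \<le> p (F y - F x) + p (F x - f)"
          by (intro seminorm_on_triangle[OF seminorm[OF p]] subspace_diff[OF subspace] FV yX x(1) f)
        \<comment> \<open>The filter \<open>atin X x\<close> is punctured; the point
          \<open>x\<close> itself lies in the ball by assumption.\<close>
        then have "y \<noteq> x \<Longrightarrow> p (F y - f) < e"
          using less[of y] y by simp
        then show ?thesis
          using x(2) FV[OF yX] yX by (auto simp: U)
      qed
      then show "\<exists>T. openin X T \<and> x \<in> T \<and> T \<subseteq> F -` U \<inter> topspace X"
        using W by blast
    qed
  qed
  moreover have "F ` topspace X \<subseteq> \<Union>{{g \<in> V. p (g - f) < e} | p f e. p \<in> P \<and> f \<in> V \<and> 0 < e}"
    using FV topspace unfolding seminorm_topology_def topology_generated_by_topspace by blast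
  ultimately show ?thesis
    unfolding seminorm_topology_def by (intro continuous_on_generated_topo)
qed

text \<open>Squeeze form of the criterion: each continuity proof below only has to supply a majorant
  \<open>h\<close> that tends to zero.\<close>

lemma continuous_map_bound:
  assumes FV: "\<And>x. x \<in> topspace X \<Longrightarrow> F x \<in> V"
    and le: "\<And>p x y. p \<in> P \<Longrightarrow> x \<in> topspace X \<Longrightarrow> y \<in> topspace X \<Longrightarrow> p (F y - F x) \<le> h p x y"
    and lim: "\<And>p x. p \<in> P \<Longrightarrow> x \<in> topspace X \<Longrightarrow> (h p x \<longlongrightarrow> 0) (atin X x)"
  shows "continuous_map X (seminorm_topology V P) F"
proof (rule continuous_mapI)
  fix p x assume p: "p \<in> P" and x: "x \<in> topspace X"
  have "norm (p (F y - F x)) \<le> h p x y" if "y \<in> topspace X" for y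
    using le[OF p x that] seminorm_on_nonneg[OF subspace seminorm[OF p]
        subspace_diff[OF subspace FV[OF that] FV[OF x]]] by simp
  then have "\<forall>\<^sub>F y in atin X x. norm (p (F y - F x)) \<le> h p x y"
    unfolding eventually_atin using x openin_topspace by blast
  then show "((\<lambda>y. p (F y - F x)) \<longlongrightarrow> 0) (atin X x)"
    by (rule Lim_null_comparison[OF _ lim[OF p x]])
qed (use FV in blast)

lemma convex_ball:
  assumes p: "p \<in> P" and f: "f \<in> V"
  shows "convex {g \<in> V. p (g - f) < e}"
proof (rule convexI)
  fix x y and u v :: real
  assume x: "x \<in> {g \<in> V. p (g - f) < e}" and y: "y \<in> {g \<in> V. p (g - f) < e}"
    and uv: "0 \<le> u" "0 \<le> v" "u + v = 1"
  have xV: "x \<in> V" and yV: "y \<in> V" using x y by auto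
  note sub = subspace_add[OF subspace] subspace_diff[OF subspace] subspace_scale[OF subspace]
  have "(u + v) *\<^sub>R f = f" using uv by simp
  then have eq: "u *\<^sub>R x + v *\<^sub>R y - f = u *\<^sub>R (x - f) + v *\<^sub>R (y - f)"
    by (simp add: algebra_simps)
  have "p (u *\<^sub>R x + v *\<^sub>R y - f) \<le> p (u *\<^sub>R (x - f)) + p (v *\<^sub>R (y - f))"
    unfolding eq by (intro seminorm_on_triangle[OF seminorm[OF p]] sub xV yV f)
  also have "\<dots> = u * p (x - f) + v * p (y - f)"
    using uv by (simp add: seminorm_on_scaleR[OF seminorm[OF p]] sub xV yV f)
  also have "\<dots> < e"
    using x y uv by (intro convex_bound_lt) auto
  finally show "u *\<^sub>R x + v *\<^sub>R y \<in> {g \<in> V. p (g - f) < e}"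
    using sub xV yV by simp
qed

text \<open>Induction on the generation of \<open>U\<close>: balls are convex whatever their centre,
  intersections of two convex sets are convex, and for a union one member containing
  \<open>x\<close> is enough.\<close>

lemma convex_neighbourhood:
  assumes "openin (seminorm_topology V P) U" "x \<in> U"
  shows "\<exists>W. openin (seminorm_topology V P) W \<and> x \<in> W \<and> convex W \<and> W \<subseteq> U"
proof -
  have "generate_topology_on {{g \<in> V. p (g - f) < e} | p f e. p \<in> P \<and> f \<in> V \<and> 0 < e} U"
    using assms(1) unfolding seminorm_topology_def openin_topology_generated_by_iff .
  then show ?thesis
    using assms(2)
  proof (induction arbitrary: x)
    case (Int A B)
    then obtain W W' where "openin (seminorm_topology V P) W" "x \<in> W" "convex W" "W \<subseteq> A"
      "openin (seminorm_topology V P) W'" "x \<in> W'" "convex W'" "W' \<subseteq> B"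
      by (meson IntD1 IntD2)
    then show ?case
      by (intro exI[of _ "W \<inter> W'"]) (auto intro: convex_Int)
  next
    case (UN K)
    then show ?case by (meson Union_iff Union_upper order_trans)
  next
    case (Basis s)
    then obtain p f e where "s = {g \<in> V. p (g - f) < e}" "p \<in> P" "f \<in> V" "0 < e"
      by blast
    then show ?case
      using Basis openin_ball convex_ball by (intro exI[of _ s]) simp
  qed simp
qed

lemma locally_convex_tvs: "locally_convex_tvs V (seminorm_topology V P)"
proof -
  let ?T = "seminorm_topology V P"
  note sub = subspace_add[OF subspace] subspace_diff[OF subspace] subspace_scale[OF subspace]
  have "continuous_map (prod_topology ?T ?T) ?T (\<lambda>(x, y). x + y)"
  proof (rule continuous_map_bound)
    fix p and x y :: "'a \<times> 'a"
    assume p: "p \<in> P" and "x \<in> topspace (prod_topology ?T ?T)" "y \<in> topspace (prod_topology ?T ?T)"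
    then have "fst x \<in> V" "snd x \<in> V" "fst y \<in> V" "snd y \<in> V" by auto
    then have "p ((fst y - fst x) + (snd y - snd x)) \<le> p (fst y - fst x) + p (snd y - snd x)"
      by (intro seminorm_on_triangle[OF seminorm[OF p]] sub)
    then show "p ((case y of (a, b) \<Rightarrow> a + b) - (case x of (a, b) \<Rightarrow> a + b))
        \<le> p (fst y - fst x) + p (snd y - snd x)"
      by (simp add: case_prod_beta algebra_simps)
  next
    fix p and x :: "'a \<times> 'a"
    assume p: "p \<in> P" and x: "x \<in> topspace (prod_topology ?T ?T)"
    show "((\<lambda>y. p (fst y - fst x) + p (snd y - snd x)) \<longlongrightarrow> 0) (atin (prod_topology ?T ?T) x)"
      by (intro tendsto_add_zero tendsto_atin[OF continuous_map_fst p x] tendsto_atin[OF continuous_map_snd p x])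
  qed (auto intro: sub)
  moreover have "continuous_map (prod_topology euclideanreal ?T) ?T (\<lambda>(c, x). c *\<^sub>R x)"
  proof (rule continuous_map_bound)
    fix p and x y :: "real \<times> 'a"
    assume p: "p \<in> P" and "x \<in> topspace (prod_topology euclideanreal ?T)"
      "y \<in> topspace (prod_topology euclideanreal ?T)"
    then have V: "snd x \<in> V" "snd y \<in> V" by auto
    \<comment> \<open>In this splitting the only seminorm not applied to a difference is taken at
      the fixed vector \<open>snd x\<close>, and the moving scalar \<open>fst y\<close> has a
      limit.\<close>
    have eq: "fst y *\<^sub>R snd y - fst x *\<^sub>R snd x
        = fst y *\<^sub>R (snd y - snd x) + (fst y - fst x) *\<^sub>R snd x"
      by (simp add: algebra_simps)
    have "p (fst y *\<^sub>R snd y - fst x *\<^sub>R snd x)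
        \<le> p (fst y *\<^sub>R (snd y - snd x)) + p ((fst y - fst x) *\<^sub>R snd x)"
      unfolding eq by (intro seminorm_on_triangle[OF seminorm[OF p]] sub V)
    then show "p ((case y of (c, a) \<Rightarrow> c *\<^sub>R a) - (case x of (c, a) \<Rightarrow> c *\<^sub>R a))
        \<le> \<bar>fst y\<bar> * p (snd y - snd x) + \<bar>fst y - fst x\<bar> * p (snd x)"
      by (simp add: case_prod_beta seminorm_on_scaleR[OF seminorm[OF p]] sub V)
  next
    fix p and x :: "real \<times> 'a"
    let ?X = "prod_topology euclideanreal ?T"
    assume p: "p \<in> P" and x: "x \<in> topspace ?X"
    have 1: "(fst \<longlongrightarrow> fst x) (atin ?X x)"
      using continuous_map_fst[of euclideanreal ?T] x
      unfolding continuous_map_atin limitin_canonical_iff by blast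
    have "((\<lambda>y. \<bar>fst y\<bar> * p (snd y - snd x) + \<bar>fst y - fst x\<bar> * p (snd x)) \<longlongrightarrow>
        \<bar>fst x\<bar> * 0 + \<bar>fst x - fst x\<bar> * p (snd x)) (atin ?X x)"
      by (intro tendsto_intros 1 tendsto_atin[OF continuous_map_snd p x])
    then show "((\<lambda>y. \<bar>fst y\<bar> * p (snd y - snd x) + \<bar>fst y - fst x\<bar> * p (snd x)) \<longlongrightarrow> 0)
        (atin ?X x)"
      by simp
  qed (auto intro: sub)
  ultimately show ?thesis
    unfolding locally_convex_tvs_def
    using subspace convex_neighbourhood by auto
qed

text \<open>Expanding around a point leaves three terms, each with at least one increment as a
  factor, so the product bound sends all of them to zero.\<close>

lemma continuous_map_bilinear:
  assumes B: "bilinear_on V B"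
    and bound: "\<And>p. p \<in> P \<Longrightarrow> \<exists>q\<in>P. \<exists>C. \<forall>x\<in>V. \<forall>y\<in>V. p (B x y) \<le> C * q x * q y"
  shows "continuous_map (prod_topology (seminorm_topology V P) (seminorm_topology V P))
    (seminorm_topology V P) (\<lambda>(x, y). B x y)"
proof -
  let ?T = "seminorm_topology V P"
  let ?X = "prod_topology ?T ?T"
  note sub = subspace_add[OF subspace] subspace_diff[OF subspace] subspace_scale[OF subspace]
  have BV: "B x y \<in> V" if "x \<in> V" "y \<in> V" for x y
    using B that unfolding bilinear_on_def by blast
  have addl: "B (x + y) z = B x z + B y z" and addr: "B z (x + y) = B z x + B z y"
    if "x \<in> V" "y \<in> V" "z \<in> V" for x y z
    using B that unfolding bilinear_on_def by blast+
  obtain Q C where Q: "\<And>p. p \<in> P \<Longrightarrow> Q p \<in> P"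
    and C: "\<And>p x y. p \<in> P \<Longrightarrow> x \<in> V \<Longrightarrow> y \<in> V \<Longrightarrow> p (B x y) \<le> C p * Q p x * Q p y"
    using bound by metis
  define h where "h p x y = C p * Q p (fst y - fst x) * Q p (snd y - snd x)
      + C p * Q p (fst x) * Q p (snd y - snd x) + C p * Q p (fst y - fst x) * Q p (snd x)" for p x y
  show ?thesis
  proof (rule continuous_map_bound)
    fix p and x y :: "'a \<times> 'a"
    assume p: "p \<in> P" and "x \<in> topspace ?X" "y \<in> topspace ?X"
    then have V: "fst x \<in> V" "snd x \<in> V" "fst y \<in> V" "snd y \<in> V" by auto
    let ?a = "fst y - fst x" and ?b = "snd y - snd x"
    have ab: "?a \<in> V" "?b \<in> V" by (intro sub V)+
    have "B (fst y) (snd y) = B (?a + fst x) (?b + snd x)" by simp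
    also have "\<dots> = (B ?a ?b + B (fst x) ?b + B ?a (snd x)) + B (fst x) (snd x)"
      using V ab by (simp only: addl addr sub) (simp add: algebra_simps)
    finally have eq: "B (fst y) (snd y) - B (fst x) (snd x) = B ?a ?b + B (fst x) ?b + B ?a (snd x)"
      by simp
    have "p (B ?a ?b + B (fst x) ?b + B ?a (snd x)) \<le> p (B ?a ?b + B (fst x) ?b) + p (B ?a (snd x))"
      by (intro seminorm_on_triangle[OF seminorm[OF p]] sub(1) BV V ab)
    moreover have "p (B ?a ?b + B (fst x) ?b) \<le> p (B ?a ?b) + p (B (fst x) ?b)"
      by (intro seminorm_on_triangle[OF seminorm[OF p]] sub(1) BV V ab)
    moreover have "p (B ?a ?b) \<le> C p * Q p ?a * Q p ?b"
      "p (B (fst x) ?b) \<le> C p * Q p (fst x) * Q p ?b"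
      "p (B ?a (snd x)) \<le> C p * Q p ?a * Q p (snd x)"
      by (intro C p V ab)+
    ultimately show "p ((case y of (a, b) \<Rightarrow> B a b) - (case x of (a, b) \<Rightarrow> B a b)) \<le> h p x y"
      unfolding case_prod_beta eq h_def by linarith
  next
    fix p and x :: "'a \<times> 'a"
    assume p: "p \<in> P" and x: "x \<in> topspace ?X"
    have "(h p x \<longlongrightarrow> C p * 0 * 0 + C p * Q p (fst x) * 0 + C p * 0 * Q p (snd x)) (atin ?X x)"
      unfolding h_def
      by (intro tendsto_intros tendsto_atin[OF continuous_map_fst Q[OF p] x]
          tendsto_atin[OF continuous_map_snd Q[OF p] x])
    then show "(h p x \<longlongrightarrow> 0) (atin ?X x)" by simp
  qed (auto intro: BV)
qed

end


subsection \<open>Smooth functions\<close>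

lemma scaleR_fun_apply [simp]: "(c *\<^sub>R f) x = c *\<^sub>R f x"
  by (simp add: scaleR_fun_def)

text \<open>Chain rule along the line through \<open>z\<close> in direction \<open>b\<close>; the
  linearity of \<open>f'\<close> turns \<open>f' (t *\<^sub>R b)\<close> into multiplication by
  \<open>f' b\<close>.\<close>

lemma partial_deriv_eq:
  assumes "(f has_derivative f') (at z)"
  shows "partial_deriv b f z = f' b"
proof -
  have "((\<lambda>t. f (z + t *\<^sub>R b)) has_derivative (\<lambda>t. f' (t *\<^sub>R b))) (at 0)"
    by (rule has_derivative_compose[where f="\<lambda>t. z + t *\<^sub>R b" and s=UNIV, simplified])
      (auto intro!: derivative_eq_intros simp: assms)
  then have "((\<lambda>t. f (z + t *\<^sub>R b)) has_field_derivative f' b) (at 0)"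
    unfolding has_field_derivative_def
    by (rule has_derivative_eq_rhs)
      (use bounded_linear.linear[OF has_derivative_bounded_linear[OF assms]]
        in \<open>auto simp: linear_scale mult.commute\<close>)
  then show ?thesis
    unfolding partial_deriv_def by (rule DERIV_imp_deriv)
qed

lemma has_derivative_partial_deriv:
  assumes "f differentiable (at z)"
  shows "(f has_derivative (\<lambda>b. partial_deriv b f z)) (at z)"
proof -
  obtain f' where f': "(f has_derivative f') (at z)" using assms unfolding differentiable_def by blast
  moreover have "f' = (\<lambda>b. partial_deriv b f z)" using partial_deriv_eq[OF f'] by auto
  ultimately show ?thesis by simp
qed

text \<open>Differentiability at every parameter \<open>s\<close> of the line, as the mean value
  theorem requires.\<close>

lemma partial_deriv_along_line:
  assumes "f differentiable (at (z + s *\<^sub>R b))"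
  shows "((\<lambda>t. f (z + t *\<^sub>R b)) has_real_derivative partial_deriv b f (z + s *\<^sub>R b)) (at s)"
proof -
  let ?D = "\<lambda>c. partial_deriv c f (z + s *\<^sub>R b)"
  note D = has_derivative_partial_deriv[OF assms]
  have "((\<lambda>t. f (z + t *\<^sub>R b)) has_derivative (\<lambda>t. ?D (t *\<^sub>R b))) (at s)"
    by (rule has_derivative_compose[where f="\<lambda>t. z + t *\<^sub>R b" and s=UNIV, simplified])
      (auto intro!: derivative_eq_intros simp: D)
  moreover have "?D (t *\<^sub>R b) = ?D b * t" for t
    using linear_scale[OF bounded_linear.linear[OF has_derivative_bounded_linear[OF D]], of t b]
    by simp
  ultimately show ?thesis
    unfolding has_field_derivative_def by simp
qed

lemma partial_deriv_const: "partial_deriv b (\<lambda>_. c) = (\<lambda>_. 0)"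
  by (auto simp: partial_deriv_def)

lemma partial_deriv_add:
  assumes "\<And>z. f differentiable (at z)" "\<And>z. g differentiable (at z)"
  shows "partial_deriv b (f + g) = partial_deriv b f + partial_deriv b g"
  unfolding plus_fun_def
  by (rule ext, rule partial_deriv_eq) (intro has_derivative_add has_derivative_partial_deriv assms)

lemma partial_deriv_mult:
  assumes "\<And>z. f differentiable (at z)" "\<And>z. g differentiable (at z)"
  shows "partial_deriv b (f * g) = partial_deriv b f * g + f * partial_deriv b g"
proof
  fix z
  have "partial_deriv b (\<lambda>z. f z * g z) z = f z * partial_deriv b g z + partial_deriv b f z * g z"
    by (rule partial_deriv_eq) (intro has_derivative_mult has_derivative_partial_deriv assms)
  then show "partial_deriv b (f * g) z = (partial_deriv b f * g + f * partial_deriv b g) z"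
    by (simp add: times_fun_def)
qed

section \<open>Closure properties of smooth functions\<close>

lemma smooth_differentiable: "smooth f \<Longrightarrow> f differentiable (at z)"
  unfolding smooth_def by (drule spec[of _ "[]"]) simp

lemma smooth_foldr_partial_deriv:
  assumes "smooth f" "set bs \<subseteq> Basis"
  shows "smooth (foldr partial_deriv bs f)"
  unfolding smooth_def
proof (intro allI impI)
  fix cs :: "'a list" and z assume "set cs \<subseteq> Basis"
  then have "foldr partial_deriv (cs @ bs) f differentiable (at z)"
    using assms unfolding smooth_def by (metis set_append Un_least)
  then show "foldr partial_deriv cs (foldr partial_deriv bs f) differentiable (at z)"
    by simp
qed

lemma smooth_partial_deriv:
  assumes "smooth f" "b \<in> Basis"
  shows "smooth (partial_deriv b f)"
  using smooth_foldr_partial_deriv[of f "[b]"] assms by simp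

text \<open>The smooth functions form the largest class of differentiable functions that is closed
  under partial derivatives in the basis directions.\<close>

lemma smooth_coinduct:
  assumes "S f"
    and diff: "\<And>f z. S f \<Longrightarrow> f differentiable (at z)"
    and closed: "\<And>f b. S f \<Longrightarrow> b \<in> Basis \<Longrightarrow> S (partial_deriv b f)"
  shows "smooth f"
proof -
  have "S (foldr partial_deriv bs f)" if "set bs \<subseteq> Basis" for bs
    using that assms(1) by (induction bs) (auto intro: closed)
  then show ?thesis unfolding smooth_def using diff by blast
qed

text \<open>
  The derivative of a product is a sum of products, so smoothness of products is proved for the
  whole algebra generated by the smooth functions at once.
\<close>

inductive smooth_generated :: "('a::euclidean_space \<Rightarrow> real) \<Rightarrow> bool" where
  base: "smooth f \<Longrightarrow> smooth_generated f"
| const: "smooth_generated (\<lambda>_. c)"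
| add: "smooth_generated f \<Longrightarrow> smooth_generated g \<Longrightarrow> smooth_generated (f + g)"
| mult: "smooth_generated f \<Longrightarrow> smooth_generated g \<Longrightarrow> smooth_generated (f * g)"

lemma smooth_generated_differentiable: "smooth_generated f \<Longrightarrow> f differentiable (at z)"
  by (induction rule: smooth_generated.induct)
    (auto simp: plus_fun_def times_fun_def intro: smooth_differentiable)

lemma smooth_generated_smooth: "smooth_generated f \<Longrightarrow> smooth f"
proof (erule smooth_coinduct[OF _ smooth_generated_differentiable])
  fix f :: "'a \<Rightarrow> real" and b :: 'a
  assume "smooth_generated f" "b \<in> Basis"
  then show "smooth_generated (partial_deriv b f)"
    by (induction rule: smooth_generated.induct)
      (simp_all add: partial_deriv_const partial_deriv_add partial_deriv_mult
        smooth_generated_differentiable smooth_generated.intros smooth_partial_deriv)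
qed

lemma smooth_const: "smooth (\<lambda>_. c)"
  and smooth_add: "smooth f \<Longrightarrow> smooth g \<Longrightarrow> smooth (f + g)"
  and smooth_mult: "smooth f \<Longrightarrow> smooth g \<Longrightarrow> smooth (f * g)"
  by (rule smooth_generated_smooth; simp add: smooth_generated.intros)+

lemma smooth_scaleR: "smooth f \<Longrightarrow> smooth (c *\<^sub>R f)"
  using smooth_mult[OF smooth_const, of f c] by (simp add: scaleR_fun_def times_fun_def)

lemma smooth_diff: "smooth f \<Longrightarrow> smooth g \<Longrightarrow> smooth (f - g)"
  using smooth_add[OF _ smooth_scaleR, of f g "-1"] by simp

lemma smooth_sum: "(\<And>i. i \<in> I \<Longrightarrow> smooth (f i)) \<Longrightarrow> smooth (\<Sum>i\<in>I. f i)"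
  by (induction I rule: infinite_finite_induct)
    (auto intro: smooth_add simp: smooth_const zero_fun_def)

lemma smooth_partial_deriv_add:
  "smooth f \<Longrightarrow> smooth g \<Longrightarrow> partial_deriv b (f + g) = partial_deriv b f + partial_deriv b g"
  by (intro partial_deriv_add smooth_differentiable)

lemma smooth_partial_deriv_mult:
  "smooth f \<Longrightarrow> smooth g \<Longrightarrow> partial_deriv b (f * g) = partial_deriv b f * g + f * partial_deriv b g"
  by (intro partial_deriv_mult smooth_differentiable)

lemma smooth_partial_deriv_scaleR:
  assumes "smooth f"
  shows "partial_deriv b (c *\<^sub>R f) = c *\<^sub>R partial_deriv b f"
proof -
  have eq: "c *\<^sub>R h = (\<lambda>_. c) * h" for h :: "'a \<Rightarrow> real"
    by (simp add: scaleR_fun_def times_fun_def)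
  show ?thesis
    unfolding eq smooth_partial_deriv_mult[OF smooth_const assms]
    by (simp add: partial_deriv_const fun_eq_iff)
qed

lemma smooth_partial_deriv_diff:
  assumes "smooth f" "smooth g"
  shows "partial_deriv b (f - g) = partial_deriv b f - partial_deriv b g"
  using smooth_partial_deriv_add[OF assms(1) smooth_scaleR[OF assms(2), of "-1"], of b]
    smooth_partial_deriv_scaleR[OF assms(2), of b "-1"] by simp

lemma smooth_partial_deriv_sum:
  "(\<And>i. i \<in> I \<Longrightarrow> smooth (f i)) \<Longrightarrow> partial_deriv b (\<Sum>i\<in>I. f i) = (\<Sum>i\<in>I. partial_deriv b (f i))"
  by (induction I rule: infinite_finite_induct)
    (auto simp: smooth_partial_deriv_add smooth_sum partial_deriv_const zero_fun_def)

section \<open>Iterated partial derivatives and independence of their order\<close>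

lemma foldr_partial_deriv_add:
  assumes "smooth f" "smooth g" "set bs \<subseteq> Basis"
  shows "foldr partial_deriv bs (f + g) = foldr partial_deriv bs f + foldr partial_deriv bs g"
  using assms(3)
  by (induction bs) (auto simp: smooth_partial_deriv_add smooth_foldr_partial_deriv assms)

lemma foldr_partial_deriv_scaleR:
  assumes "smooth f" "set bs \<subseteq> Basis"
  shows "foldr partial_deriv bs (c *\<^sub>R f) = c *\<^sub>R foldr partial_deriv bs f"
  using assms(2)
  by (induction bs) (auto simp: smooth_partial_deriv_scaleR smooth_foldr_partial_deriv assms)

lemma smooth_continuous: "smooth f \<Longrightarrow> continuous_on S f"
  by (intro continuous_at_imp_continuous_on ballI differentiable_imp_continuous_within smooth_differentiable)

text \<open>
  The second difference on the left is symmetric in \<open>a\<close> and \<open>b\<close>, whence the mixed partial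
  derivatives agree in the limit \<open>h \<rightarrow> 0\<close>.
\<close>

lemma second_difference:
  assumes f: "smooth f" and a: "a \<in> Basis" and h: "0 < h"
  obtains \<xi> \<eta> where "0 < \<xi>" "\<xi> < h" "0 < \<eta>" "\<eta> < h"
    "f (z + h *\<^sub>R a + h *\<^sub>R b) - f (z + h *\<^sub>R a) - f (z + h *\<^sub>R b) + f z
      = h * h * partial_deriv b (partial_deriv a f) (z + \<xi> *\<^sub>R a + \<eta> *\<^sub>R b)"
proof -
  \<comment> \<open>\<open>?g h - ?g 0\<close> is the second difference. The mean value theorem is
    applied to it in direction \<open>a\<close>, and then to the resulting first difference of
    \<open>partial_deriv a f\<close> in direction \<open>b\<close>.\<close>
  let ?g = "\<lambda>s. f ((z + h *\<^sub>R b) + s *\<^sub>R a) - f (z + s *\<^sub>R a)"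
  let ?g' = "\<lambda>s. partial_deriv a f ((z + h *\<^sub>R b) + s *\<^sub>R a) - partial_deriv a f (z + s *\<^sub>R a)"
  have "(?g has_real_derivative ?g' s) (at s)" for s
    by (intro DERIV_diff partial_deriv_along_line smooth_differentiable f)
  then obtain \<xi> where \<xi>: "0 < \<xi>" "\<xi> < h" "?g h - ?g 0 = (h - 0) * ?g' \<xi>"
    using MVT2[of 0 h ?g ?g'] h by blast
  let ?k = "\<lambda>t. partial_deriv a f ((z + \<xi> *\<^sub>R a) + t *\<^sub>R b)"
  let ?k' = "\<lambda>t. partial_deriv b (partial_deriv a f) ((z + \<xi> *\<^sub>R a) + t *\<^sub>R b)"
  have "(?k has_real_derivative ?k' t) (at t)" for t
    by (intro partial_deriv_along_line smooth_differentiable smooth_partial_deriv f a)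
  then obtain \<eta> where \<eta>: "0 < \<eta>" "\<eta> < h" "?k h - ?k 0 = (h - 0) * ?k' \<eta>"
    using MVT2[of 0 h ?k ?k'] h by blast
  show ?thesis
    by (rule that[of \<xi> \<eta>]) (use \<xi> \<eta> in \<open>simp_all add: algebra_simps\<close>)
qed

lemma partial_deriv_commute:
  assumes f: "smooth f" and a: "a \<in> Basis" and b: "b \<in> Basis"
  shows "partial_deriv a (partial_deriv b f) = partial_deriv b (partial_deriv a f)"
proof
  fix z
  let ?F = "partial_deriv a (partial_deriv b f)" and ?G = "partial_deriv b (partial_deriv a f)"
  show "?F z = ?G z"
  proof (rule ccontr)
    assume "?F z \<noteq> ?G z"
    \<comment> \<open>Half the gap: no single value can be closer than this to both
      \<open>?F z\<close> and \<open>?G z\<close>.\<close>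
    then have e: "0 < dist (?F z) (?G z) / 2" (is "0 < ?e") by simp
    have "\<exists>d>0. \<forall>w. dist w z < d \<longrightarrow> dist (H w) (H z) < ?e" if "smooth H" for H :: "'a \<Rightarrow> real"
      using smooth_continuous[OF that, of UNIV] e unfolding continuous_on_iff by blast
    then obtain d d' where d: "0 < d" "\<And>w. dist w z < d \<Longrightarrow> dist (?F w) (?F z) < ?e"
      and d': "0 < d'" "\<And>w. dist w z < d' \<Longrightarrow> dist (?G w) (?G z) < ?e"
      using assms by (metis smooth_partial_deriv)
    \<comment> \<open>Each intermediate point is reached from \<open>z\<close> by two steps shorter
      than \<open>h\<close>, so it stays within \<open>2 * h\<close> and hence within both
      radii.\<close>
    define h where "h = min d d' / 2"
    have h: "0 < h" "2 * h \<le> d" "2 * h \<le> d'" using d d' by (auto simp: h_def)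
    have near: "dist (z + s *\<^sub>R u + t *\<^sub>R v) z < 2 * h"
      if "0 < s" "s < h" "0 < t" "t < h" "u \<in> Basis" "v \<in> Basis" for s t u v
    proof -
      have "norm (s *\<^sub>R u + t *\<^sub>R v) \<le> s + t"
        using norm_triangle_ineq[of "s *\<^sub>R u" "t *\<^sub>R v"] that by simp
      then show ?thesis using that by (simp add: dist_norm add.assoc)
    qed
    obtain s t where st: "0 < s" "s < h" "0 < t" "t < h"
      "f (z + h *\<^sub>R a + h *\<^sub>R b) - f (z + h *\<^sub>R a) - f (z + h *\<^sub>R b) + f z
        = h * h * ?G (z + s *\<^sub>R a + t *\<^sub>R b)"
      using second_difference[OF f a h(1)] by metis
    obtain s' t' where st': "0 < s'" "s' < h" "0 < t'" "t' < h"
      "f (z + h *\<^sub>R b + h *\<^sub>R a) - f (z + h *\<^sub>R b) - f (z + h *\<^sub>R a) + f z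
        = h * h * ?F (z + s' *\<^sub>R b + t' *\<^sub>R a)"
      using second_difference[OF f b h(1)] by metis
    \<comment> \<open>Both sides are the same second difference, expanded once with \<open>a\<close>
      first and once with \<open>b\<close> first.\<close>
    have "h * h * ?G (z + s *\<^sub>R a + t *\<^sub>R b) = h * h * ?F (z + s' *\<^sub>R b + t' *\<^sub>R a)"
      using st(5) st'(5) by (simp add: algebra_simps)
    then have "?G (z + s *\<^sub>R a + t *\<^sub>R b) = ?F (z + s' *\<^sub>R b + t' *\<^sub>R a)"
      using h by simp
    moreover have "dist (?G (z + s *\<^sub>R a + t *\<^sub>R b)) (?G z) < ?e"
      using near[OF st(1-4) a b] h by (intro d') simp
    moreover have "dist (?F (z + s' *\<^sub>R b + t' *\<^sub>R a)) (?F z) < ?e"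
      using near[OF st'(1-4) b a] h by (intro d) simp
    ultimately show False
      by (simp add: dist_real_def abs_if split: if_splits)
  qed
qed

lemma foldr_partial_deriv_commute:
  assumes "smooth f" "a \<in> Basis" "set bs \<subseteq> Basis"
  shows "foldr partial_deriv bs (partial_deriv a f) = partial_deriv a (foldr partial_deriv bs f)"
  using assms(3)
  by (induction bs) (auto simp: partial_deriv_commute smooth_foldr_partial_deriv assms)

text \<open>The head \<open>b\<close> of \<open>bs\<close> is commuted past the part of
  \<open>cs\<close> that precedes an occurrence of \<open>b\<close>; removing that occurrence leaves
  lists that again agree as multisets.\<close>

lemma foldr_partial_deriv_mset:
  assumes "smooth f" "set bs \<subseteq> Basis" "mset bs = mset cs"
  shows "foldr partial_deriv bs f = foldr partial_deriv cs f"
  using assms(2,3)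
proof (induction bs arbitrary: cs)
  case (Cons b bs)
  obtain cs1 cs2 where cs: "cs = cs1 @ b # cs2"
    using Cons.prems(2) by (metis list.set_intros(1) mset_eq_setD split_list)
  have sub: "set cs \<subseteq> Basis"
    using Cons.prems mset_eq_setD by blast
  have "foldr partial_deriv bs f = foldr partial_deriv (cs1 @ cs2) f"
    using Cons.prems cs by (intro Cons.IH) auto
  then have "foldr partial_deriv (b # bs) f
      = partial_deriv b (foldr partial_deriv cs1 (foldr partial_deriv cs2 f))"
    by simp
  also have "\<dots> = foldr partial_deriv cs1 (partial_deriv b (foldr partial_deriv cs2 f))"
    using sub cs assms(1)
    by (intro foldr_partial_deriv_commute[symmetric]) (auto intro: smooth_foldr_partial_deriv)
  finally show ?case by (simp add: cs)
qed simp


subsection \<open>The seminorms of smooth functions\<close>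

lemma distinct_basis_list: "distinct (basis_list :: 'a::euclidean_space list)"
  and set_basis_list: "set (basis_list :: 'a list) = Basis"
proof -
  have "\<exists>bs. distinct bs \<and> set bs = (Basis :: 'a set)"
    using finite_distinct_list[OF finite_Basis] by blast
  from someI_ex[OF this] show "distinct (basis_list :: 'a list)" "set (basis_list :: 'a list) = Basis"
    unfolding basis_list_def by auto
qed

definition multi_list :: "('a::euclidean_space \<Rightarrow> nat) \<Rightarrow> 'a list" where
  "multi_list \<alpha> = concat (map (\<lambda>b. replicate (\<alpha> b) b) basis_list)"

lemma multi_deriv_eq_foldr: "multi_deriv \<alpha> f = foldr partial_deriv (multi_list \<alpha>) f"
proof -
  have rep: "foldr partial_deriv (replicate n b) g = (partial_deriv b ^^ n) g" for n b g
    by (induction n) auto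
  have "foldr (\<lambda>b. partial_deriv b ^^ \<alpha> b) bs f
      = foldr partial_deriv (concat (map (\<lambda>b. replicate (\<alpha> b) b) bs)) f" for bs
    by (induction bs) (auto simp: rep)
  then show ?thesis by (simp add: multi_deriv_def multi_list_def)
qed

lemma set_multi_list: "set (multi_list \<alpha>) \<subseteq> Basis"
  by (auto simp: multi_list_def set_basis_list)

lemma length_multi_list: "length (multi_list \<alpha>) = multi_order \<alpha>"
proof -
  have "length (multi_list \<alpha>) = sum_list (map \<alpha> basis_list)"
    by (simp add: multi_list_def length_concat o_def)
  also have "\<dots> = multi_order \<alpha>"
    by (simp add: multi_order_def sum_list_distinct_conv_sum_set distinct_basis_list set_basis_list)
  finally show ?thesis .
qed

text \<open>\<open>count_list bs\<close> is the multi-index of the list \<open>bs\<close>. Entries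
  outside \<open>Basis\<close> would be lost, since \<open>multi_list\<close> reads a multi-index
  only there.\<close>

lemma mset_multi_list:
  assumes "set bs \<subseteq> (Basis :: 'a::euclidean_space set)"
  shows "mset (multi_list (count_list bs)) = mset bs"
proof (rule multiset_eqI)
  fix a :: 'a
  \<comment> \<open>Distinctness ensures that each direction contributes exactly one block.\<close>
  have *: "count (mset (concat (map (\<lambda>b. replicate (\<alpha> b) b) cs))) a
      = (if a \<in> set cs then \<alpha> a else 0)" if "distinct cs" for cs and \<alpha> :: "'a \<Rightarrow> nat"
    using that by (induction cs) auto
  show "count (mset (multi_list (count_list bs))) a = count (mset bs) a"
    using assms *[OF distinct_basis_list, of "count_list bs"]
    by (auto simp: multi_list_def set_basis_list count_mset count_list_0_iff)
qed

lemma foldr_partial_deriv_eq_multi_deriv: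
  assumes "smooth f" "set bs \<subseteq> Basis"
  shows "foldr partial_deriv bs f = multi_deriv (count_list bs) f"
  unfolding multi_deriv_eq_foldr
  by (rule foldr_partial_deriv_mset[symmetric])
    (simp_all add: assms set_multi_list mset_multi_list)

lemma finite_bounded_lists: "finite {bs. set bs \<subseteq> (Basis :: 'a::euclidean_space set) \<and> length bs \<le> n}"
  by (rule finite_lists_length_le[OF finite_Basis])

lemma sup_norm_on_bdd:
  assumes "smooth f" "compact K"
  shows "bdd_above (insert 0 ((\<lambda>z. \<bar>f z\<bar>) ` K))"
  using compact_imp_bounded[OF compact_continuous_image[OF continuous_on_rabs[OF smooth_continuous[OF assms(1)]] assms(2)]]
  by (simp add: bounded_imp_bdd_above)

text \<open>
  Bounding derivatives along arbitrary lists of directions, not just in the order of the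
  multi-indices, makes the Leibniz rule a plain induction on the order.
\<close>

definition jet_bound :: "'a::euclidean_space set \<Rightarrow> nat \<Rightarrow> real \<Rightarrow> ('a \<Rightarrow> real) \<Rightarrow> bool" where
  "jet_bound K n M f \<longleftrightarrow>
     (\<forall>bs. set bs \<subseteq> Basis \<longrightarrow> length bs \<le> n \<longrightarrow> (\<forall>z\<in>K. \<bar>foldr partial_deriv bs f z\<bar> \<le> M))"

lemma jet_boundI:
  assumes "\<And>bs z. set bs \<subseteq> Basis \<Longrightarrow> length bs \<le> n \<Longrightarrow> z \<in> K \<Longrightarrow> \<bar>foldr partial_deriv bs f z\<bar> \<le> M"
  shows "jet_bound K n M f"
  using assms unfolding jet_bound_def by blast

lemma jet_boundD:
  assumes "jet_bound K n M f" "set bs \<subseteq> Basis" "length bs \<le> n" "z \<in> K"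
  shows "\<bar>foldr partial_deriv bs f z\<bar> \<le> M"
  using assms unfolding jet_bound_def by blast

lemma jet_bound_apply: "jet_bound K n M f \<Longrightarrow> z \<in> K \<Longrightarrow> \<bar>f z\<bar> \<le> M"
  using jet_boundD[of K n M f "[]" z] by simp

lemma jet_bound_partial_deriv:
  assumes "jet_bound K (Suc n) M f" "b \<in> Basis"
  shows "jet_bound K n M (partial_deriv b f)"
proof (rule jet_boundI)
  fix bs :: "'a list" and z assume "set bs \<subseteq> Basis" "length bs \<le> n" "z \<in> K"
  then show "\<bar>foldr partial_deriv bs (partial_deriv b f) z\<bar> \<le> M"
    using jet_boundD[OF assms(1), of "bs @ [b]" z] assms(2) by simp
qed

lemma jet_bound_mono: "jet_bound K n M f \<Longrightarrow> m \<le> n \<Longrightarrow> jet_bound K m M f"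
  unfolding jet_bound_def by auto

lemma jet_bound_add:
  assumes "smooth f" "smooth g" "jet_bound K n M f" "jet_bound K n N g"
  shows "jet_bound K n (M + N) (f + g)"
proof (rule jet_boundI)
  fix bs :: "'a list" and z assume bs: "set bs \<subseteq> Basis" "length bs \<le> n" "z \<in> K"
  show "\<bar>foldr partial_deriv bs (f + g) z\<bar> \<le> M + N"
    using jet_boundD[OF assms(3) bs] jet_boundD[OF assms(4) bs]
    by (simp add: foldr_partial_deriv_add assms bs)
qed

lemma jet_bound_scaleR:
  assumes "smooth f" "jet_bound K n M f"
  shows "jet_bound K n (\<bar>c\<bar> * M) (c *\<^sub>R f)"
proof (rule jet_boundI)
  fix bs :: "'a list" and z assume bs: "set bs \<subseteq> Basis" "length bs \<le> n" "z \<in> K"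
  show "\<bar>foldr partial_deriv bs (c *\<^sub>R f) z\<bar> \<le> \<bar>c\<bar> * M"
    using jet_boundD[OF assms(2) bs]
    by (simp add: foldr_partial_deriv_scaleR assms bs abs_mult mult_left_mono)
qed

lemma jet_bound_diff:
  assumes "smooth f" "smooth g" "jet_bound K n M f" "jet_bound K n N g"
  shows "jet_bound K n (M + N) (f - g)"
  using jet_bound_add[OF assms(1) smooth_scaleR[OF assms(2)] assms(3) jet_bound_scaleR[OF assms(2,4)], of "-1"]
  by simp

lemma foldr_partial_deriv_zero: "set bs \<subseteq> Basis \<Longrightarrow> foldr partial_deriv bs 0 = 0"
  using foldr_partial_deriv_scaleR[OF smooth_const[of 0], of bs 0] by simp

lemma jet_bound_sum:
  assumes "finite I" "\<And>i. i \<in> I \<Longrightarrow> smooth (f i)" "\<And>i. i \<in> I \<Longrightarrow> jet_bound K n M (f i)"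
  shows "jet_bound K n (real (card I) * M) (\<Sum>i\<in>I. f i)"
  using assms
proof (induction I)
  case empty
  show ?case unfolding sum.empty by (rule jet_boundI) (simp only: foldr_partial_deriv_zero, simp)
next
  case (insert i I)
  then have "jet_bound K n (M + real (card I) * M) (f i + (\<Sum>i\<in>I. f i))"
    by (intro jet_bound_add smooth_sum) auto
  moreover have "real (card (insert i I)) * M = M + real (card I) * M"
    using insert.hyps by (simp add: distrib_right)
  ultimately show ?case
    unfolding sum.insert[OF insert.hyps] by (simp only:)
qed

text \<open>Every differentiation doubles the number of products in the Leibniz expansion, whence
  \<open>2 ^ n\<close>. Each product is bounded by \<open>M * N\<close>.\<close>

lemma jet_bound_mult:
  assumes "smooth f" "smooth g" "jet_bound K n M f" "jet_bound K n N g"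
  shows "jet_bound K n (2 ^ n * (M * N)) (f * g)"
  using assms
proof (induction n arbitrary: f g)
  case 0
  show ?case
  proof (rule jet_boundI)
    fix bs :: "'a list" and z assume bs: "length bs \<le> 0" "z \<in> K"
    have "\<bar>f z\<bar> * \<bar>g z\<bar> \<le> M * N"
      using jet_bound_apply[OF 0(3) bs(2)] jet_bound_apply[OF 0(4) bs(2)] by (intro mult_mono') auto
    then show "\<bar>foldr partial_deriv bs (f * g) z\<bar> \<le> 2 ^ 0 * (M * N)"
      using bs by (simp add: abs_mult)
  qed
next
  case (Suc n)
  show ?case
  proof (rule jet_boundI)
    fix bs :: "'a list" and z assume bs: "set bs \<subseteq> Basis" "length bs \<le> Suc n" "z \<in> K"
    show "\<bar>foldr partial_deriv bs (f * g) z\<bar> \<le> 2 ^ Suc n * (M * N)"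
    \<comment> \<open>\<open>foldr\<close> applies the last entry first, so splitting at the end
      exposes the derivative that acts directly on \<open>f * g\<close>.\<close>
    proof (cases bs rule: rev_cases)
      case Nil
      have *: "\<bar>f z\<bar> * \<bar>g z\<bar> \<le> M * N"
        using jet_bound_apply[OF Suc.prems(3) bs(3)] jet_bound_apply[OF Suc.prems(4) bs(3)]
        by (intro mult_mono') auto
      \<comment> \<open>The undifferentiated product meets the bound without the power of two;
        enlarging the constant requires this sign, which the point \<open>z\<close> in
        \<open>K\<close> supplies.\<close>
      then have "0 \<le> M * N" by (meson abs_ge_zero mult_nonneg_nonneg order_trans)
      then have "1 * (M * N) \<le> 2 ^ Suc n * (M * N)"
        by (intro mult_right_mono one_le_power) auto
      then show ?thesis using * Nil by (simp add: abs_mult)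
    next
      case (snoc cs b)
      then have b: "b \<in> Basis" and cs: "set cs \<subseteq> Basis" "length cs \<le> n" using bs by auto
      let ?h = "partial_deriv b f * g + f * partial_deriv b g"
      note sm = Suc.prems(1,2) smooth_partial_deriv[OF Suc.prems(1) b] smooth_partial_deriv[OF Suc.prems(2) b]
      note lower = jet_bound_mono[OF Suc.prems(3)] jet_bound_mono[OF Suc.prems(4)]
      have "jet_bound K n (2 ^ n * (M * N) + 2 ^ n * (M * N)) ?h"
        by (intro jet_bound_add smooth_mult Suc.IH sm
            jet_bound_partial_deriv[OF Suc.prems(3) b] jet_bound_partial_deriv[OF Suc.prems(4) b] lower) auto
      from jet_boundD[OF this cs bs(3)]
      have "\<bar>foldr partial_deriv cs ?h z\<bar> \<le> 2 ^ Suc n * (M * N)"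
        by (simp add: algebra_simps)
      then show ?thesis
        by (simp add: snoc smooth_partial_deriv_mult Suc.prems)
    qed
  qed
qed

text \<open>The index set is infinite because multi-indices are arbitrary outside
  \<open>Basis\<close>. The family of values is nevertheless finite, as it factors through the
  finitely many lists of at most \<open>n\<close> basis directions.\<close>

lemma bdd_above_multi_deriv_sup_norms:
  "bdd_above ((\<lambda>\<alpha>. sup_norm_on K (multi_deriv \<alpha> f)) ` {\<alpha>. multi_order \<alpha> \<le> n})"
proof (rule bdd_above_finite, rule finite_subset)
  show "(\<lambda>\<alpha>. sup_norm_on K (multi_deriv \<alpha> f)) ` {\<alpha>. multi_order \<alpha> \<le> n}
      \<subseteq> (\<lambda>bs. sup_norm_on K (foldr partial_deriv bs f)) ` {bs. set bs \<subseteq> Basis \<and> length bs \<le> n}"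
  proof (rule image_subsetI)
    fix \<alpha> :: "'a \<Rightarrow> nat" assume "\<alpha> \<in> {\<alpha>. multi_order \<alpha> \<le> n}"
    then show "sup_norm_on K (multi_deriv \<alpha> f)
        \<in> (\<lambda>bs. sup_norm_on K (foldr partial_deriv bs f)) ` {bs. set bs \<subseteq> Basis \<and> length bs \<le> n}"
      by (intro image_eqI[of _ _ "multi_list \<alpha>"])
        (simp_all add: multi_deriv_eq_foldr set_multi_list length_multi_list)
  qed
qed (intro finite_imageI finite_bounded_lists)

lemma jet_bound_smooth_seminorm:
  assumes f: "smooth f" and K: "compact K"
  shows "jet_bound K n (smooth_seminorm K n f) f"
proof (rule jet_boundI)
  fix bs :: "'a list" and z assume bs: "set bs \<subseteq> Basis" "length bs \<le> n" and z: "z \<in> K"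
  let ?g = "foldr partial_deriv bs f"
  have "\<bar>?g z\<bar> \<le> sup_norm_on K ?g"
    unfolding sup_norm_on_def
    by (intro cSup_upper sup_norm_on_bdd smooth_foldr_partial_deriv f K bs) (use z in auto)
  \<comment> \<open>Symmetry of mixed partial derivatives enters here: the directions in
    \<open>bs\<close> are sorted into the order used by \<open>multi_deriv\<close>.\<close>
  also have "\<dots> = sup_norm_on K (multi_deriv (count_list bs) f)"
    by (simp add: foldr_partial_deriv_eq_multi_deriv f bs)
  also have "\<dots> \<le> smooth_seminorm K n f"
    unfolding smooth_seminorm_def
  proof (rule cSUP_upper[OF _ bdd_above_multi_deriv_sup_norms])
    have "multi_order (count_list bs) = length bs"
      using mset_multi_list[OF bs(1)] by (metis length_multi_list size_mset)
    then show "count_list bs \<in> {\<alpha>. multi_order \<alpha> \<le> n}"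
      using bs by simp
  qed
  finally show "\<bar>?g z\<bar> \<le> smooth_seminorm K n f" .
qed

text \<open>For empty \<open>K\<close> the jet bound is vacuous while the seminorm is
  \<open>0\<close>; the assumption \<open>0 \<le> M\<close> covers this case.\<close>

lemma smooth_seminorm_le:
  assumes M: "0 \<le> M" and f: "jet_bound K n M f"
  shows "smooth_seminorm K n f \<le> M"
  unfolding smooth_seminorm_def
proof (rule cSUP_least)
  show "{\<alpha> :: 'a \<Rightarrow> nat. multi_order \<alpha> \<le> n} \<noteq> {}"
    by (auto simp: multi_order_def intro: exI[of _ "\<lambda>_. 0"])
next
  fix \<alpha> :: "'a \<Rightarrow> nat" assume "\<alpha> \<in> {\<alpha>. multi_order \<alpha> \<le> n}"
  then have "\<bar>multi_deriv \<alpha> f z\<bar> \<le> M" if "z \<in> K" for z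
    unfolding multi_deriv_eq_foldr
    by (intro jet_boundD[OF f set_multi_list _ that]) (simp add: length_multi_list)
  then show "sup_norm_on K (multi_deriv \<alpha> f) \<le> M"
    unfolding sup_norm_on_def using M by (intro cSup_least) auto
qed

lemma smooth_seminorm_nonneg:
  assumes "smooth f" "compact K"
  shows "0 \<le> smooth_seminorm K n f"
proof -
  have "smooth (multi_deriv (\<lambda>_. 0) f)"
    unfolding multi_deriv_eq_foldr by (rule smooth_foldr_partial_deriv[OF assms(1) set_multi_list])
  then have "0 \<le> sup_norm_on K (multi_deriv (\<lambda>_. 0) f)"
    unfolding sup_norm_on_def by (intro cSup_upper sup_norm_on_bdd assms) auto
  also have "\<dots> \<le> smooth_seminorm K n f"
    unfolding smooth_seminorm_def
    by (rule cSUP_upper[OF _ bdd_above_multi_deriv_sup_norms]) (simp add: multi_order_def)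
  finally show ?thesis .
qed

lemma smooth_seminorm_add:
  assumes "smooth f" "smooth g" "compact K"
  shows "smooth_seminorm K n (f + g) \<le> smooth_seminorm K n f + smooth_seminorm K n g"
  by (intro smooth_seminorm_le jet_bound_add jet_bound_smooth_seminorm add_nonneg_nonneg
      smooth_seminorm_nonneg assms)

lemma smooth_seminorm_scaleR:
  assumes "smooth f" "compact K"
  shows "smooth_seminorm K n (c *\<^sub>R f) = \<bar>c\<bar> * smooth_seminorm K n f"
proof (rule antisym)
  have le: "smooth_seminorm K n (c *\<^sub>R f) \<le> \<bar>c\<bar> * smooth_seminorm K n f"
    if "smooth f" for c and f :: "'a \<Rightarrow> real"
    by (intro smooth_seminorm_le jet_bound_scaleR jet_bound_smooth_seminorm mult_nonneg_nonneg
        abs_ge_zero smooth_seminorm_nonneg assms that)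
  show "smooth_seminorm K n (c *\<^sub>R f) \<le> \<bar>c\<bar> * smooth_seminorm K n f"
    by (rule le[OF assms(1)])
  show "\<bar>c\<bar> * smooth_seminorm K n f \<le> smooth_seminorm K n (c *\<^sub>R f)"
  proof (cases "c = 0")
    case True
    then show ?thesis
      using smooth_seminorm_nonneg[OF smooth_scaleR[OF assms(1), of 0] assms(2), of n] by simp
  next
    \<comment> \<open>The inequality already proved, applied to \<open>c *\<^sub>R f\<close> with
      scalar \<open>1 / c\<close>, yields the reverse one.\<close>
    case False
    then have "smooth_seminorm K n f \<le> \<bar>1 / c\<bar> * smooth_seminorm K n (c *\<^sub>R f)"
      using le[OF smooth_scaleR[OF assms(1), of c], of "1 / c"] by simp
    then show ?thesis using False by (simp add: field_simps)
  qed
qed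


subsection \<open>The Poisson bracket\<close>

text \<open>A pair of particle and coordinate indexes one conjugate pair \<open>x_dir p\<close>,
  \<open>v_dir p\<close>. This flattens the sum over particles of inner products into a single
  sum.\<close>

definition x_dir :: "'k \<times> 'd \<Rightarrow> ('d::finite, 'k::finite) phase" where
  "x_dir p = axis (fst p) (axis (snd p) 1, 0)"

definition v_dir :: "'k \<times> 'd \<Rightarrow> ('d::finite, 'k::finite) phase" where
  "v_dir p = axis (fst p) (0, axis (snd p) 1)"

lemma x_dir_Basis: "x_dir p \<in> Basis" and v_dir_Basis: "v_dir p \<in> Basis"
  by (simp_all add: x_dir_def v_dir_def axis_in_Basis_iff Basis_prod_def)

definition coord_bracket :: "('i \<Rightarrow> 'a) \<Rightarrow> ('i \<Rightarrow> 'a) \<Rightarrow> 'i set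
    \<Rightarrow> ('a::euclidean_space \<Rightarrow> real) \<Rightarrow> ('a \<Rightarrow> real) \<Rightarrow> 'a \<Rightarrow> real" where
  "coord_bracket X V I f g = (\<Sum>p\<in>I. partial_deriv (X p) f * partial_deriv (V p) g
     - partial_deriv (V p) f * partial_deriv (X p) g)"

lemma sum_fun_apply: "(\<Sum>i\<in>I. F i) z = (\<Sum>i\<in>I. F i z)"
  by (induction I rule: infinite_finite_induct) auto

lemma poisson_eq_coord_bracket: "poisson f g = coord_bracket x_dir v_dir UNIV f g"
proof
  fix z
  show "poisson f g z = coord_bracket x_dir v_dir UNIV f g z"
    unfolding poisson_def grad_x_def grad_v_def coord_bracket_def UNIV_Times_UNIV[symmetric]
    by (simp add: sum_fun_apply inner_vec_def x_dir_def v_dir_def sum_subtractf sum.cartesian_product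
        case_prod_beta)
qed

section \<open>The canonical bracket along families of conjugate directions\<close>

context
  fixes X V :: "'i \<Rightarrow> 'a::euclidean_space" and I :: "'i set"
  assumes X: "\<And>p. X p \<in> Basis" and V: "\<And>p. V p \<in> Basis"
begin

abbreviation "bracket \<equiv> coord_bracket X V I"

lemma smooth_coord_bracket:
  assumes "smooth f" "smooth g"
  shows "smooth (bracket f g)"
  unfolding coord_bracket_def
  by (intro smooth_sum smooth_diff smooth_mult smooth_partial_deriv assms X V)

lemma coord_bracket_antisym: "bracket f g = - bracket g f"
  unfolding coord_bracket_def sum_negf[symmetric]
  by (intro sum.cong refl) (simp add: mult.commute)

lemma coord_bracket_add_right:
  assumes "smooth g" "smooth h"
  shows "bracket f (g + h) = bracket f g + bracket f h"
  unfolding coord_bracket_def sum.distrib[symmetric]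
  by (intro sum.cong refl) (simp add: smooth_partial_deriv_add assms algebra_simps)

lemma coord_bracket_scaleR_right:
  assumes "smooth g"
  shows "bracket f (c *\<^sub>R g) = c *\<^sub>R bracket f g"
  unfolding coord_bracket_def scaleR_sum_right
  by (intro sum.cong refl) (simp add: smooth_partial_deriv_scaleR assms fun_eq_iff algebra_simps)

lemma coord_bracket_nested:
  assumes f: "smooth f" and g: "smooth g" and h: "smooth h"
  shows "bracket f (bracket g h) z = (\<Sum>p\<in>I. \<Sum>q\<in>I.
    partial_deriv (X p) f z *
      (partial_deriv (V p) (partial_deriv (X q) g) z * partial_deriv (V q) h z
       + partial_deriv (X q) g z * partial_deriv (V p) (partial_deriv (V q) h) z
       - partial_deriv (V p) (partial_deriv (V q) g) z * partial_deriv (X q) h z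
       - partial_deriv (V q) g z * partial_deriv (V p) (partial_deriv (X q) h) z)
    - partial_deriv (V p) f z *
      (partial_deriv (X p) (partial_deriv (X q) g) z * partial_deriv (V q) h z
       + partial_deriv (X q) g z * partial_deriv (X p) (partial_deriv (V q) h) z
       - partial_deriv (X p) (partial_deriv (V q) g) z * partial_deriv (X q) h z
       - partial_deriv (V q) g z * partial_deriv (X p) (partial_deriv (X q) h) z))"
proof -
  note smooth = smooth_partial_deriv[OF _ X] smooth_partial_deriv[OF _ V] f g h
  \<comment> \<open>The direction \<open>b\<close> is kept general because the outer bracket uses
    both \<open>X p\<close> and \<open>V p\<close>.\<close>
  have D: "partial_deriv b (bracket g h) z = (\<Sum>q\<in>I.
      partial_deriv b (partial_deriv (X q) g) z * partial_deriv (V q) h z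
       + partial_deriv (X q) g z * partial_deriv b (partial_deriv (V q) h) z
       - partial_deriv b (partial_deriv (V q) g) z * partial_deriv (X q) h z
       - partial_deriv (V q) g z * partial_deriv b (partial_deriv (X q) h) z)" for b
    unfolding coord_bracket_def
    by (simp add: smooth_partial_deriv_sum smooth_partial_deriv_diff smooth_partial_deriv_mult
        smooth_mult smooth_diff smooth sum_fun_apply algebra_simps)
  show ?thesis
    unfolding coord_bracket_def[of X V I f] sum_fun_apply
    by (intro sum.cong refl) (simp only: D times_fun_apply minus_apply sum_distrib_left sum_subtractf[symmetric])
qed

lemma coord_bracket_jacobi:
  assumes f: "smooth f" and g: "smooth g" and h: "smooth h"
  shows "bracket f (bracket g h) + bracket g (bracket h f) + bracket h (bracket f g) = 0"
proof
  fix z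
  \<comment> \<open>\<open>S\<close> is the summand from \<open>coord_bracket_nested\<close> and
    \<open>T\<close> its cyclic sum. The terms of \<open>S f g h p q\<close> with a second
    derivative of \<open>g\<close> cancel against those of \<open>S h f g q p\<close>, and
    cyclically for the other functions.\<close>
  define S where "S f g h p q = partial_deriv (X p) f z *
      (partial_deriv (V p) (partial_deriv (X q) g) z * partial_deriv (V q) h z
       + partial_deriv (X q) g z * partial_deriv (V p) (partial_deriv (V q) h) z
       - partial_deriv (V p) (partial_deriv (V q) g) z * partial_deriv (X q) h z
       - partial_deriv (V q) g z * partial_deriv (V p) (partial_deriv (X q) h) z)
    - partial_deriv (V p) f z *
      (partial_deriv (X p) (partial_deriv (X q) g) z * partial_deriv (V q) h z
       + partial_deriv (X q) g z * partial_deriv (X p) (partial_deriv (V q) h) z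
       - partial_deriv (X p) (partial_deriv (V q) g) z * partial_deriv (X q) h z
       - partial_deriv (V q) g z * partial_deriv (X p) (partial_deriv (X q) h) z)"
    for f g h p q
  define T where "T p q = S f g h p q + S g h f p q + S h f g p q" for p q
  \<comment> \<open>Normal form for mixed derivatives: \<open>X\<close> outside \<open>V\<close>.
    Equations between two \<open>X\<close> or two \<open>V\<close> derivatives are used only from
    order \<open>q p\<close> to order \<open>p q\<close>, so the rewriting terminates.\<close>
  have comm:
    "partial_deriv (X q) (partial_deriv (X p) u) z = partial_deriv (X p) (partial_deriv (X q) u) z"
    "partial_deriv (V q) (partial_deriv (V p) u) z = partial_deriv (V p) (partial_deriv (V q) u) z"
    "partial_deriv (V p) (partial_deriv (X q) u) z = partial_deriv (X q) (partial_deriv (V p) u) z"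
    if "smooth u" for u p q
    using partial_deriv_commute[OF that] X V by simp_all
  have anti: "T p q = - T q p" for p q
    unfolding T_def S_def
      comm(1)[OF f, of q p] comm(1)[OF g, of q p] comm(1)[OF h, of q p]
      comm(2)[OF f, of q p] comm(2)[OF g, of q p] comm(2)[OF h, of q p]
      comm(3)[OF f] comm(3)[OF g] comm(3)[OF h]
    by (simp only: algebra_simps)
  have "(\<Sum>p\<in>I. \<Sum>q\<in>I. T p q) = (\<Sum>p\<in>I. \<Sum>q\<in>I. - T q p)"
    by (intro sum.cong refl anti)
  also have "\<dots> = - (\<Sum>p\<in>I. \<Sum>q\<in>I. T p q)"
    by (subst sum.swap) (simp add: sum_negf)
  finally have "(\<Sum>p\<in>I. \<Sum>q\<in>I. T p q) = 0" by simp
  moreover have "bracket f (bracket g h) z + bracket g (bracket h f) z + bracket h (bracket f g) z = (\<Sum>p\<in>I. \<Sum>q\<in>I. T p q)"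
    unfolding T_def S_def coord_bracket_nested[OF f g h] coord_bracket_nested[OF g h f]
      coord_bracket_nested[OF h f g] by (simp only: sum.distrib)
  ultimately show "(bracket f (bracket g h) + bracket g (bracket h f) + bracket h (bracket f g)) z = 0 z"
    by simp
qed

text \<open>The constant counts \<open>card I\<close> index pairs with two products each, times the
  Leibniz factor \<open>2 ^ n\<close>. One order is spent on the first derivatives of
  \<open>f\<close> and \<open>g\<close>.\<close>

lemma smooth_seminorm_coord_bracket:
  assumes f: "smooth f" and g: "smooth g" and K: "compact K" and I: "finite I"
  shows "smooth_seminorm K n (bracket f g)
    \<le> (real (card I) * (2 * 2 ^ n)) * smooth_seminorm K (Suc n) f * smooth_seminorm K (Suc n) g"
proof (rule smooth_seminorm_le)
  let ?M = "smooth_seminorm K (Suc n) f" and ?N = "smooth_seminorm K (Suc n) g"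
  note smooth = smooth_mult smooth_partial_deriv[OF _ X] smooth_partial_deriv[OF _ V] f g
  have M: "jet_bound K n ?M (partial_deriv b f)" and N: "jet_bound K n ?N (partial_deriv b g)"
    if "b \<in> Basis" for b
    by (intro jet_bound_partial_deriv[OF _ that] jet_bound_smooth_seminorm f g K)+
  have "jet_bound K n (real (card I) * (2 ^ n * (?M * ?N) + 2 ^ n * (?M * ?N))) (bracket f g)"
    unfolding coord_bracket_def
    by (intro jet_bound_sum I smooth_diff jet_bound_diff jet_bound_mult smooth M N X V)
  then show "jet_bound K n ((real (card I) * (2 * 2 ^ n)) * ?M * ?N) (bracket f g)"
    by (simp add: algebra_simps)
  show "0 \<le> (real (card I) * (2 * 2 ^ n)) * ?M * ?N"
    by (intro mult_nonneg_nonneg smooth_seminorm_nonneg f g K) auto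
qed

end

text \<open>A linear \<open>\<sigma>\<close> carries the line through \<open>z\<close> in direction
  \<open>b\<close> to the line through \<open>\<sigma> z\<close> in direction
  \<open>\<sigma> b\<close>, and \<open>f\<close> takes the same values along both.\<close>

lemma partial_deriv_linear_invariant:
  assumes "linear \<sigma>" "\<And>z. f (\<sigma> z) = f z"
  shows "partial_deriv (\<sigma> b) f (\<sigma> z) = partial_deriv b f z"
proof -
  have "f (\<sigma> z + t *\<^sub>R \<sigma> b) = f (z + t *\<^sub>R b)" for t
    using assms by (metis linear_add linear_scale)
  then show ?thesis unfolding partial_deriv_def by simp
qed

lemma poisson_symmetric:
  fixes f g :: "('d::finite, 'k::finite) phase \<Rightarrow> real"
  assumes \<pi>: "\<pi> permutes (UNIV :: 'k set)"
    and f: "\<And>z. f (\<chi> i. z $ \<pi> i) = f z" and g: "\<And>z. g (\<chi> i. z $ \<pi> i) = g z"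
  shows "poisson f g (\<chi> i. z $ \<pi> i) = poisson f g z"
proof -
  define \<sigma> where "\<sigma> z = (\<chi> i. z $ \<pi> i)" for z :: "('d, 'k) phase"
  have lin: "linear \<sigma>"
    by (rule linearI) (simp_all add: \<sigma>_def vec_eq_iff)
  \<comment> \<open>Slot \<open>i\<close> of \<open>\<sigma> z\<close> holds particle
    \<open>\<pi> i\<close>, so derivatives in slot \<open>i\<close> at \<open>\<sigma> z\<close>
    become derivatives in slot \<open>\<pi> i\<close> at \<open>z\<close>.\<close>
  have axis: "\<sigma> (axis (\<pi> i) u) = axis i u" for i u
    using permutes_inj[OF \<pi>] by (auto simp: \<sigma>_def axis_def vec_eq_iff dest: injD)
  have "partial_deriv (axis i u) f (\<sigma> z) = partial_deriv (axis (\<pi> i) u) f z"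
    "partial_deriv (axis i u) g (\<sigma> z) = partial_deriv (axis (\<pi> i) u) g z" for i u
    using partial_deriv_linear_invariant[OF lin, of f "axis (\<pi> i) u" z]
      partial_deriv_linear_invariant[OF lin, of g "axis (\<pi> i) u" z] f g
    by (simp_all add: axis) (simp_all add: \<sigma>_def)
  then have grad: "grad_x i f (\<sigma> z) = grad_x (\<pi> i) f z" "grad_v i f (\<sigma> z) = grad_v (\<pi> i) f z"
    "grad_x i g (\<sigma> z) = grad_x (\<pi> i) g z" "grad_v i g (\<sigma> z) = grad_v (\<pi> i) g z" for i
    by (simp_all add: grad_x_def grad_v_def)
  have "poisson f g (\<sigma> z)
      = (\<Sum>i\<in>UNIV. (\<lambda>i. grad_x i f z \<bullet> grad_v i g z - grad_v i f z \<bullet> grad_x i g z) (\<pi> i))"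
    by (simp add: poisson_def grad)
  also have "\<dots> = poisson f g z"
    unfolding poisson_def
    by (rule sum.reindex_bij_betw[OF permutes_imp_bij[OF \<pi>]])
  finally show ?thesis by (simp add: \<sigma>_def)
qed

section \<open>Lie algebra axioms for the symmetric observables\<close>

lemma subspace_observables: "subspace (\<gg> :: (('d::finite, 'k::finite) phase \<Rightarrow> real) set)"
  unfolding \<gg>_def subspace_def
  using smooth_const[of 0] by (auto simp: smooth_add smooth_scaleR zero_fun_def)

lemma observables_smooth: "f \<in> \<gg> \<Longrightarrow> smooth f"
  by (simp add: \<gg>_def)

lemma bracket_observables:
  assumes "f \<in> \<gg>" "g \<in> \<gg>"
  shows "\<gg>_bracket f g \<in> \<gg>"
proof -
  have "smooth (poisson f g)"
    unfolding poisson_eq_coord_bracket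
    by (intro smooth_coord_bracket x_dir_Basis v_dir_Basis observables_smooth assms)
  moreover have "poisson f g (\<chi> i. z $ \<pi> i) = poisson f g z" if "\<pi> permutes UNIV" for \<pi> z
    using poisson_symmetric[OF that] assms that unfolding \<gg>_def by blast
  ultimately have "poisson f g \<in> \<gg>" by (simp add: \<gg>_def)
  then show ?thesis
    unfolding \<gg>_bracket_def by (rule subspace_scale[OF subspace_observables])
qed

lemma bracket_antisym: "\<gg>_bracket f g = - \<gg>_bracket g f"
  unfolding \<gg>_bracket_def poisson_eq_coord_bracket
  by (subst coord_bracket_antisym) (simp_all add: x_dir_Basis v_dir_Basis)

lemma bilinear_on_bracket: "bilinear_on (\<gg> :: (('d::finite, 'k::finite) phase \<Rightarrow> real) set) \<gg>_bracket"
proof -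
  note B = x_dir_Basis v_dir_Basis observables_smooth
  have add: "\<gg>_bracket h (f + g) = \<gg>_bracket h f + \<gg>_bracket h g"
    if "f \<in> \<gg>" "g \<in> \<gg>" for f g h :: "('d, 'k) phase \<Rightarrow> real"
    unfolding \<gg>_bracket_def poisson_eq_coord_bracket
    by (subst coord_bracket_add_right) (simp_all add: B that scaleR_add_right)
  have scale: "\<gg>_bracket f (c *\<^sub>R g) = c *\<^sub>R \<gg>_bracket f g"
    if "g \<in> \<gg>" for c and f g :: "('d, 'k) phase \<Rightarrow> real"
    unfolding \<gg>_bracket_def poisson_eq_coord_bracket
    by (subst coord_bracket_scaleR_right) (simp_all add: B that)
  show ?thesis
    unfolding bilinear_on_def
  proof (intro conjI ballI allI)
    fix f g h :: "('d, 'k) phase \<Rightarrow> real" and c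
    assume fg: "f \<in> \<gg>" "g \<in> \<gg>"
    show "\<gg>_bracket f g \<in> \<gg>" by (rule bracket_observables[OF fg])
    show "\<gg>_bracket h (f + g) = \<gg>_bracket h f + \<gg>_bracket h g" by (rule add[OF fg])
    \<comment> \<open>Antisymmetry transfers additivity from the right argument to the left
      one.\<close>
    then show "\<gg>_bracket (f + g) h = \<gg>_bracket f h + \<gg>_bracket g h"
      unfolding bracket_antisym[of _ h] by simp
    show "\<gg>_bracket f (c *\<^sub>R g) = c *\<^sub>R \<gg>_bracket f g" by (rule scale[OF fg(2)])
    show "\<gg>_bracket (c *\<^sub>R f) g = c *\<^sub>R \<gg>_bracket f g"
      unfolding bracket_antisym[of _ g] scale[OF fg(1)] by simp
  qed
qed

lemma bracket_jacobi:
  assumes "f \<in> \<gg>" "g \<in> \<gg>" "h \<in> (\<gg> :: (('d::finite, 'k::finite) phase \<Rightarrow> real) set)"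
  shows "\<gg>_bracket f (\<gg>_bracket g h) + \<gg>_bracket g (\<gg>_bracket h f) + \<gg>_bracket h (\<gg>_bracket f g) = 0"
proof -
  let ?B = "coord_bracket x_dir v_dir UNIV :: _ \<Rightarrow> _ \<Rightarrow> ('d, 'k) phase \<Rightarrow> real"
  let ?k = "real CARD('k)"
  note B = x_dir_Basis v_dir_Basis observables_smooth assms
  \<comment> \<open>The normalising factor leaves each nested bracket as the same square, so the
    identity reduces to that for \<open>coord_bracket\<close>.\<close>
  have eq: "\<gg>_bracket u (\<gg>_bracket v w) = (?k * ?k) *\<^sub>R ?B u (?B v w)"
    if "smooth v" "smooth w" for u v w :: "('d, 'k) phase \<Rightarrow> real"
    unfolding \<gg>_bracket_def poisson_eq_coord_bracket
    by (subst coord_bracket_scaleR_right) (simp_all add: B that smooth_coord_bracket)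
  have "?B f (?B g h) + ?B g (?B h f) + ?B h (?B f g) = 0"
    by (intro coord_bracket_jacobi B)
  then show ?thesis
    by (simp add: eq B flip: scaleR_add_right)
qed

lemma seminormed_space_observables:
  "seminormed_space (\<gg> :: (('d::finite, 'k::finite) phase \<Rightarrow> real) set)
    {smooth_seminorm K n | K n. compact K \<and> 1 \<le> n}"
proof
  fix p :: "(('d, 'k) phase \<Rightarrow> real) \<Rightarrow> real"
  assume "p \<in> {smooth_seminorm K n | K n. compact K \<and> 1 \<le> n}"
  then show "seminorm_on \<gg> p"
    by (auto simp: seminorm_on_def observables_smooth smooth_seminorm_add smooth_seminorm_scaleR)
next
  have "compact ({} :: ('d, 'k) phase set)" "1 \<le> (1 :: nat)"
    by simp_all
  then show "{smooth_seminorm K n | K n. compact (K :: ('d, 'k) phase set) \<and> 1 \<le> n} \<noteq> {}"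
    by blast
qed (rule subspace_observables)

text \<open>The outer factor \<open>CARD('k)\<close> is the normalisation of the bracket, and
  \<open>CARD('k \<times> 'd)\<close> counts the conjugate pairs.\<close>

lemma smooth_seminorm_bracket:
  fixes f g :: "('d::finite, 'k::finite) phase \<Rightarrow> real"
  assumes "f \<in> \<gg>" "g \<in> \<gg>" "compact K"
  shows "smooth_seminorm K n (\<gg>_bracket f g)
    \<le> (real CARD('k) * (real CARD('k \<times> 'd) * (2 * 2 ^ n)))
        * smooth_seminorm K (Suc n) f * smooth_seminorm K (Suc n) g"
proof -
  have "smooth (poisson f g)"
    unfolding poisson_eq_coord_bracket
    by (intro smooth_coord_bracket x_dir_Basis v_dir_Basis observables_smooth assms)
  then have "smooth_seminorm K n (\<gg>_bracket f g) = real CARD('k) * smooth_seminorm K n (poisson f g)"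
    by (simp add: \<gg>_bracket_def smooth_seminorm_scaleR assms)
  also have "\<dots> \<le> real CARD('k) * ((real CARD('k \<times> 'd) * (2 * 2 ^ n))
      * smooth_seminorm K (Suc n) f * smooth_seminorm K (Suc n) g)"
    unfolding poisson_eq_coord_bracket
    by (intro mult_left_mono smooth_seminorm_coord_bracket x_dir_Basis v_dir_Basis
        observables_smooth assms finite) auto
  finally show ?thesis by (simp only: mult.assoc)
qed

theorem proposition2p1:
  "lie_algebra (\<gg> :: (('d::finite, 'k::finite) phase \<Rightarrow> real) set) \<gg>_topology \<gg>_bracket \<and>
   bilinear_on (\<gg> :: (('d, 'k) phase \<Rightarrow> real) set) \<gg>_bracket \<and>
   continuous_map (prod_topology \<gg>_topology \<gg>_topology)
     (\<gg>_topology :: (('d, 'k) phase \<Rightarrow> real) topology)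
     (\<lambda>(f, g). \<gg>_bracket f g)"
proof -
  interpret seminormed_space "\<gg> :: (('d, 'k) phase \<Rightarrow> real) set"
    "{smooth_seminorm K n | K n. compact K \<and> 1 \<le> n}"
    by (rule seminormed_space_observables)
  have "lie_algebra (\<gg> :: (('d, 'k) phase \<Rightarrow> real) set) \<gg>_topology \<gg>_bracket"
    unfolding lie_algebra_def \<gg>_topology_def
    by (intro conjI ballI locally_convex_tvs bilinear_on_bracket bracket_antisym bracket_jacobi)
  moreover have "continuous_map (prod_topology \<gg>_topology \<gg>_topology)
      (\<gg>_topology :: (('d, 'k) phase \<Rightarrow> real) topology) (\<lambda>(f, g). \<gg>_bracket f g)"
    unfolding \<gg>_topology_def
  proof (rule continuous_map_bilinear[OF bilinear_on_bracket])
    fix p :: "(('d, 'k) phase \<Rightarrow> real) \<Rightarrow> real"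
    assume "p \<in> {smooth_seminorm K n | K n. compact K \<and> 1 \<le> n}"
    then obtain K n where p: "p = smooth_seminorm K n" and K: "compact K" by blast
    \<comment> \<open>The witness for both arguments keeps the same \<open>K\<close> and raises the
      order by one, so it still belongs to the family.\<close>
    have "smooth_seminorm K (Suc n) \<in> {smooth_seminorm K n | K n. compact K \<and> 1 \<le> n}"
      using K by force
    then show "\<exists>q\<in>{smooth_seminorm K n | K n. compact K \<and> 1 \<le> n}.
        \<exists>C. \<forall>f\<in>\<gg>. \<forall>g\<in>\<gg>. p (\<gg>_bracket f g) \<le> C * q f * q g"
      using smooth_seminorm_bracket[OF _ _ K] unfolding p by blast
  qed
  ultimately show ?thesis using bilinear_on_bracket by blast
qed

end
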